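(* If $E\subset\mathbb{R}^N$ is a Lipschitz bounded open set, then there exist $\xi_0\in\Theta$ and $\eta>0$ such that $${\xi_0}_{|\partial^*E}\cdot\nu_E\ge\eta\qquad\mathcal{H}^{N-1}\text{-a.e. on }\partial^*E.$$
   Context: $\Theta$ is the space of $C^1$ maps $\theta:\mathbb{R}^N\to\mathbb{R}^N$ with $\theta$ and $D\theta$ bounded. A Lipschitz open set is one such that near each boundary point, up to a rigid change of coordinates, $\partial E$ is the graph of a Lipschitz function of $N-1$ variables and $E$ lies locally below this graph. $\mathcal{H}^{N-1}$ is the $(N-1)$-dimensional Hausdorff measure. The reduced boundary $\partial^*E$ is the set of $x$ such that $|\nabla\chi_E|(B(x,\rho))>0$ for all $\rho>0$ and $\nu_E(x)=-\lim_{\rho\to0}\frac{\nabla\chi_E(B(x,\rho))}{|\nabla\chi_E|(B(x,\rho))}$ exists with Euclidean norm $1$; $\nu_E$ is the outward unit normal (for a Lipschitz set it coincides $\mathcal{H}^{N-1}$-a.e. on $\partial E$ with the usual one). *)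

theory Defs
  imports "HOL-Analysis.Analysis"
begin

definition C1_on_space :: "('a::euclidean_space \<Rightarrow> 'b::euclidean_space) \<Rightarrow> bool" where
  "C1_on_space f \<longleftrightarrow>
     (\<exists>D :: 'a \<Rightarrow> 'a \<Rightarrow>\<^sub>L 'b.
        (\<forall>x. (f has_derivative blinfun_apply (D x)) (at x)) \<and> continuous_on UNIV D)"

text \<open>The space \<open>\<Theta>\<close>; boundedness of the derivative is with respect to the operator norm.\<close>

definition Theta_space :: "('a::euclidean_space \<Rightarrow> 'a) set" where
  "Theta_space =
     {\<theta>. bounded (range \<theta>) \<and>
         (\<exists>D :: 'a \<Rightarrow> 'a \<Rightarrow>\<^sub>L 'a.
            (\<forall>x. (\<theta> has_derivative blinfun_apply (D x)) (at x)) \<and>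
            continuous_on UNIV D \<and> bounded (range D))}"

text \<open>
  The new coordinates of a point \<open>y\<close> are those of \<open>T y = a + Q y\<close>, with \<open>Q\<close> orthogonal
  (reflections are allowed, as is needed for intervals in dimension one).  The coordinate along
  the basis vector \<open>e\<close> plays the role of the last one, \<open>R\<^sup>N\<^sup>-\<^sup>1\<close> is the coordinate hyperplane
  \<open>{z. z \<bullet> e = 0}\<close>, and \<open>z - (z \<bullet> e) *\<^sub>R e\<close> is the list of the other \<open>N - 1\<close> coordinates of \<open>z\<close>.
  Taking \<open>g\<close> to be defined on the whole hyperplane is no restriction, since real-valued
  Lipschitz functions extend.
\<close>

definition Lipschitz_open_set :: "'a::euclidean_space set \<Rightarrow> bool" where
  "Lipschitz_open_set E \<longleftrightarrow> open E \<and>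
     (\<forall>x\<in>frontier E. \<exists>U Q a e g L.
        open U \<and> x \<in> U \<and> orthogonal_transformation Q \<and> e \<in> Basis \<and>
        L-lipschitz_on {z. z \<bullet> e = 0} (g :: 'a \<Rightarrow> real) \<and>
        (let T = (\<lambda>y. a + Q y); rest = (\<lambda>z. z - (z \<bullet> e) *\<^sub>R e) in
           U \<inter> frontier E = {y \<in> U. T y \<bullet> e = g (rest (T y))} \<and>
           U \<inter> E = {y \<in> U. T y \<bullet> e < g (rest (T y))}))"

text \<open>
  Hausdorff (outer) measure of integer dimension \<open>k\<close>, with the usual normalisation.  Empty
  covering sets contribute \<open>0\<close>, and \<open>0 ^ 0 = 1\<close> makes the case \<open>k = 0\<close> the counting measure.
\<close>

definition hausdorff_weight :: "nat \<Rightarrow> 'a::euclidean_space set \<Rightarrow> ennreal" where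
  "hausdorff_weight k C =
     (if C = {} then 0 else ennreal (unit_ball_vol (real k) * (diameter C / 2) ^ k))"

definition hausdorff_premeasure :: "nat \<Rightarrow> real \<Rightarrow> 'a::euclidean_space set \<Rightarrow> ennreal" where
  "hausdorff_premeasure k \<delta> A =
     (INF C \<in> {C :: nat \<Rightarrow> 'a set. (\<forall>i. bounded (C i) \<and> diameter (C i) \<le> \<delta>) \<and> A \<subseteq> (\<Union>i. C i)}.
        (\<Sum>i. hausdorff_weight k (C i)))"

definition hausdorff_measure :: "nat \<Rightarrow> 'a::euclidean_space set \<Rightarrow> ennreal" where
  "hausdorff_measure k A = (SUP \<delta> \<in> {0<..}. hausdorff_premeasure k \<delta> A)"

text \<open>
  Finite vector-valued Borel measures are represented by countably additive set functions; their
  values on non-Borel sets are irrelevant.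
\<close>

definition vector_measure :: "('a::euclidean_space set \<Rightarrow> 'b::euclidean_space) \<Rightarrow> bool" where
  "vector_measure \<mu> \<longleftrightarrow>
     (\<forall>A :: nat \<Rightarrow> 'a set. range A \<subseteq> sets borel \<longrightarrow> disjoint_family A \<longrightarrow>
        (\<lambda>i. \<mu> (A i)) sums \<mu> (\<Union>i. A i))"

definition total_variation ::
    "('a::euclidean_space set \<Rightarrow> 'b::euclidean_space) \<Rightarrow> 'a set \<Rightarrow> ennreal" where
  "total_variation \<mu> B =
     (SUP A \<in> {A :: nat \<Rightarrow> 'a set. range A \<subseteq> sets borel \<and> disjoint_family A \<and> (\<Union>i. A i) = B}.
        (\<Sum>i. ennreal (norm (\<mu> (A i)))))"

text \<open>
  Integral of \<open>f\<close> with respect to the finite signed measure \<open>m\<close>, through a decomposition of \<open>m\<close> as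
  a difference of finite measures; the value \<open>I\<close> does not depend on the decomposition for
  bounded Borel \<open>f\<close>, the only case used below.
\<close>

definition has_signed_integral ::
    "('a::euclidean_space set \<Rightarrow> real) \<Rightarrow> ('a \<Rightarrow> real) \<Rightarrow> real \<Rightarrow> bool" where
  "has_signed_integral m f I \<longleftrightarrow>
     (\<exists>P M. finite_measure P \<and> finite_measure M \<and> sets P = sets borel \<and> sets M = sets borel \<and>
        (\<forall>A \<in> sets borel. m A = measure P A - measure M A) \<and>
        integrable P f \<and> integrable M f \<and>
        I = integral\<^sup>L P f - integral\<^sup>L M f)"

text \<open>
  \<open>\<mu>\<close> is the distributional gradient of the characteristic function of \<open>E\<close>, tested against
  compactly supported \<open>C\<^sup>1\<close> functions.
\<close>

definition distributional_gradient_of_indicator ::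
    "'a::euclidean_space set \<Rightarrow> ('a set \<Rightarrow> 'a) \<Rightarrow> bool" where
  "distributional_gradient_of_indicator E \<mu> \<longleftrightarrow> vector_measure \<mu> \<and>
     (\<forall>\<phi> :: 'a \<Rightarrow> real. C1_on_space \<phi> \<longrightarrow> compact (closure {x. \<phi> x \<noteq> 0}) \<longrightarrow>
        (\<forall>b\<in>Basis. has_signed_integral (\<lambda>A. \<mu> A \<bullet> b) \<phi>
           (- (LINT x:E|lebesgue. frechet_derivative \<phi> (at x) b))))"

definition finite_perimeter :: "'a::euclidean_space set \<Rightarrow> bool" where
  "finite_perimeter E \<longleftrightarrow>
     E \<in> sets lebesgue \<and> (\<exists>\<mu>. distributional_gradient_of_indicator E \<mu>)"

text \<open>For a set of finite perimeter the gradient is uniquely determined on Borel sets.\<close>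

definition gradient_of_indicator :: "'a::euclidean_space set \<Rightarrow> 'a set \<Rightarrow> 'a" where
  "gradient_of_indicator E = (SOME \<mu>. distributional_gradient_of_indicator E \<mu>)"

definition density_quotient :: "'a::euclidean_space set \<Rightarrow> 'a \<Rightarrow> real \<Rightarrow> 'a" where
  "density_quotient E x \<rho> =
     gradient_of_indicator E (ball x \<rho>) /\<^sub>R
       enn2real (total_variation (gradient_of_indicator E) (ball x \<rho>))"

definition outer_normal :: "'a::euclidean_space set \<Rightarrow> 'a \<Rightarrow> 'a" where
  "outer_normal E x = - Lim (at_right 0) (density_quotient E x)"

text \<open>
  As usual, the reduced boundary is a notion for sets of finite perimeter, among them all bounded
  Lipschitz open sets; by convention it is empty for other sets.
\<close>

definition reduced_boundary :: "'a::euclidean_space set \<Rightarrow> 'a set" where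
  "reduced_boundary E =
     {x. finite_perimeter E \<and>
         (\<forall>\<rho>>0. total_variation (gradient_of_indicator E) (ball x \<rho>) > 0) \<and>
         (\<exists>l. (density_quotient E x \<longlongrightarrow> l) (at_right 0)) \<and>
         norm (outer_normal E x) = 1}"

end

theory Submission
  imports Defs
begin

text \<open>
  Near a boundary point \<open>E\<close> lies below a Lipschitz graph, so in a neighbourhood \<open>B\<close> it is stable
  under moving by \<open>- t v\<close> for all \<open>v\<close> in a ball of radius \<open>c\<close> around the upward direction \<open>u\<close>.
  Hence the distributional gradient \<open>\<mu>\<close> of the indicator satisfies \<open>\<mu> A \<bullet> v \<le> 0\<close> for Borel
  \<open>A \<subseteq> B\<close> and all such \<open>v\<close>; optimising over \<open>v\<close> gives \<open>c * norm (\<mu> A) \<le> - \<mu> A \<bullet> u\<close>.  The same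
  bound then holds for the total variation, so the outer normal satisfies \<open>\<nu> \<bullet> u \<ge> c\<close> at every
  point of the reduced boundary in \<open>B\<close>, without any exceptional set.  The reduced boundary lies
  in the compact topological boundary, and finitely many of the directions \<open>u\<close> are glued with
  bump functions.
\<close>

section \<open>Functions of class \<open>C\<^sup>1\<close>\<close>

text \<open>Squaring the positive part removes its kink: at 0 the difference quotient is
  \<open>max 0 h\<close> itself, which tends to 0. This is the source of all cutoff functions
  below.\<close>

lemma has_real_derivative_max_0_power2:
  "((\<lambda>t::real. (max 0 t)\<^sup>2) has_real_derivative 2 * max 0 t) (at t)"
proof -
  consider "t > 0" | "t < 0" | "t = 0" by linarith
  then show ?thesis
  proof cases
    case 1
    have "((\<lambda>t::real. t\<^sup>2) has_real_derivative 2 * max 0 t) (at t)"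
      using 1 by (auto intro!: derivative_eq_intros)
    then show ?thesis
      by (rule has_field_derivative_transform_within_open[where S = "{0<..}"]) (use 1 in auto)
  next
    case 2
    have "((\<lambda>t::real. 0) has_real_derivative 2 * max 0 t) (at t)"
      using 2 by (auto intro!: derivative_eq_intros)
    then show ?thesis
      by (rule has_field_derivative_transform_within_open[where S = "{..<0}"]) (use 2 in auto)
  next
    case 3
    have "((\<lambda>h::real. max 0 h) \<longlongrightarrow> max 0 0) (at 0)"
      by (intro tendsto_intros)
    moreover have "(max 0 h)\<^sup>2 / h = max 0 h" for h :: real
      by (auto simp: max_def power2_eq_square)
    ultimately show ?thesis
      using 3 by (simp add: DERIV_def)
  qed
qed

lemma C1_on_space_const: "C1_on_space (\<lambda>x. c)"
  unfolding C1_on_space_def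
  by (rule exI[of _ "\<lambda>x. 0"]) (auto simp: zero_blinfun.rep_eq)

lemma C1_on_space_add:
  assumes "C1_on_space f" "C1_on_space g"
  shows "C1_on_space (\<lambda>x. f x + g x)"
proof -
  obtain D D' where "\<And>x. (f has_derivative blinfun_apply (D x)) (at x)" "continuous_on UNIV D"
    "\<And>x. (g has_derivative blinfun_apply (D' x)) (at x)" "continuous_on UNIV D'"
    using assms unfolding C1_on_space_def by blast
  then show ?thesis unfolding C1_on_space_def
    by (intro exI[of _ "\<lambda>x. D x + D' x"])
       (auto simp: plus_blinfun.rep_eq intro!: has_derivative_add continuous_intros)
qed

lemma C1_on_space_sum:
  "finite I \<Longrightarrow> (\<And>i. i \<in> I \<Longrightarrow> C1_on_space (f i)) \<Longrightarrow> C1_on_space (\<lambda>x. \<Sum>i\<in>I. f i x)"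
  by (induction I rule: finite_induct) (simp_all add: C1_on_space_const C1_on_space_add)

lemma C1_on_space_compose_real:
  fixes f :: "'a::euclidean_space \<Rightarrow> real" and h :: "real \<Rightarrow> real"
  assumes "C1_on_space f" and h: "\<And>t. (h has_real_derivative h' t) (at t)" "continuous_on UNIV h'"
  shows "C1_on_space (\<lambda>x. h (f x))"
proof -
  obtain D where D: "\<And>x. (f has_derivative blinfun_apply (D x)) (at x)" "continuous_on UNIV D"
    using assms unfolding C1_on_space_def by blast
  have cf: "continuous_on UNIV f"
    using D(1) has_derivative_continuous continuous_at_imp_continuous_on by blast
  show ?thesis unfolding C1_on_space_def
  proof (intro exI[of _ "\<lambda>x. h' (f x) *\<^sub>R D x"] conjI allI)
    fix x
    have "(h has_derivative (\<lambda>u. u * h' (f x))) (at (f x))"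
      using h(1)[of "f x"] unfolding has_field_derivative_def
      by (rule has_derivative_eq_rhs) (simp add: fun_eq_iff mult.commute)
    from has_derivative_compose[OF D(1) this]
    show "((\<lambda>x. h (f x)) has_derivative blinfun_apply (h' (f x) *\<^sub>R D x)) (at x)"
      by (simp add: scaleR_blinfun.rep_eq mult.commute)
  next
    show "continuous_on UNIV (\<lambda>x. h' (f x) *\<^sub>R D x)"
      by (intro continuous_intros D continuous_on_compose2[OF h(2)] cf) auto
  qed
qed

lemma C1_on_space_max_0_power2:
  fixes f :: "'a::euclidean_space \<Rightarrow> real"
  assumes "C1_on_space f"
  shows "C1_on_space (\<lambda>x. (max 0 (f x))\<^sup>2)"
  by (rule C1_on_space_compose_real[OF assms has_real_derivative_max_0_power2])
     (intro continuous_intros)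

lemma C1_on_space_imp_continuous_on:
  "C1_on_space f \<Longrightarrow> continuous_on UNIV f"
  unfolding C1_on_space_def
  using has_derivative_continuous continuous_at_imp_continuous_on by blast

section \<open>Compactly supported cutoffs and elements of \<open>Theta_space\<close>\<close>

text \<open>The squared norm in place of the norm keeps the inner function differentiable at
  \<open>c\<close>; the outer square makes the result C1, the regularity asked of test functions and
  of \<open>Theta_space\<close>.\<close>

definition bump :: "'a::euclidean_space \<Rightarrow> real \<Rightarrow> 'a \<Rightarrow> real" where
  "bump c r y = (max 0 (r\<^sup>2 - (y - c) \<bullet> (y - c)))\<^sup>2"

lemma C1_on_space_bump: "C1_on_space (bump c r)"
proof -
  have "C1_on_space (\<lambda>y. r\<^sup>2 - (y - c) \<bullet> (y - c))" unfolding C1_on_space_def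
  proof (intro exI[of _ "\<lambda>y. -2 *\<^sub>R blinfun_inner_right (y - c)"] conjI allI)
    fix x
    show "((\<lambda>y. r\<^sup>2 - (y - c) \<bullet> (y - c)) has_derivative
             blinfun_apply (-2 *\<^sub>R blinfun_inner_right (x - c))) (at x)"
      by (auto intro!: derivative_eq_intros 
          simp: scaleR_blinfun.rep_eq uminus_blinfun.rep_eq blinfun_inner_right.rep_eq inner_commute)
  next
    show "continuous_on UNIV (\<lambda>y. -2 *\<^sub>R blinfun_inner_right (y - c))"
      by (intro continuous_intros bounded_linear.continuous_on[OF bounded_linear_blinfun_inner_right])
  qed
  from C1_on_space_max_0_power2[OF this] show ?thesis
    by (simp add: bump_def[abs_def])
qed

lemma bump_nonneg: "bump c r y \<ge> 0"
  by (simp add: bump_def)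

lemma bump_pos_iff:
  assumes "r > 0"
  shows "bump c r y > 0 \<longleftrightarrow> y \<in> ball c r"
proof -
  have "bump c r y > 0 \<longleftrightarrow> (norm (y - c))\<^sup>2 < r\<^sup>2"
    by (auto simp: bump_def power2_norm_eq_inner max_def)
  also have "\<dots> \<longleftrightarrow> norm (y - c) < r"
    using assms by (metis norm_ge_zero less_imp_le power2_less_imp_less power_strict_mono zero_less_numeral)
  finally show ?thesis by (simp add: dist_norm norm_minus_commute)
qed

lemma bump_eq_0: "r > 0 \<Longrightarrow> y \<notin> ball c r \<Longrightarrow> bump c r y = 0"
  using bump_pos_iff[of r c y] bump_nonneg[of c r y] by linarith

lemma compact_closure_support_bump:
  assumes "r > 0"
  shows "compact (closure {y. bump c r y \<noteq> 0})"
proof -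
  have "{y. bump c r y \<noteq> 0} \<subseteq> ball c r" using bump_eq_0[OF assms] by blast
  then show ?thesis using bounded_subset[OF bounded_ball] by (metis compact_closure)
qed

text \<open>The derivative vanishes off the closed support, since the function is zero on that open
  set, and is continuous on the compact support.\<close>

lemma C1_bounded_derivative:
  fixes \<phi> :: "'a::euclidean_space \<Rightarrow> 'b::euclidean_space"
  assumes "C1_on_space \<phi>" "compact (closure {x. \<phi> x \<noteq> 0})"
  obtains D :: "'a \<Rightarrow> 'a \<Rightarrow>\<^sub>L 'b" where "\<And>x. (\<phi> has_derivative blinfun_apply (D x)) (at x)"
    "continuous_on UNIV D" "bounded (range D)"
proof -
  obtain D where D: "\<And>x. (\<phi> has_derivative blinfun_apply (D x)) (at x)" "continuous_on UNIV D"
    using assms unfolding C1_on_space_def by blast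
  define K where "K = closure {x. \<phi> x \<noteq> 0}"
  have "D x = 0" if "x \<notin> K" for x
  proof -
    have "(\<phi> has_derivative (\<lambda>x. 0)) (at x)"
    proof (rule has_derivative_transform_within_open[of "\<lambda>x. 0"])
      show "open (- K)" unfolding K_def using closed_closure open_Compl by blast
      show "x \<in> - K" using that by simp
      show "\<And>y. y \<in> - K \<Longrightarrow> 0 = \<phi> y" using closure_subset by (force simp: K_def)
    qed simp
    from has_derivative_unique[OF D(1) this] show ?thesis
      by (intro blinfun_eqI) (simp add: zero_blinfun.rep_eq)
  qed
  then have "range D \<subseteq> insert 0 (D ` K)" by blast
  moreover have "compact (D ` K)"
    unfolding K_def by (intro compact_continuous_image assms continuous_on_subset[OF D(2)]) auto
  ultimately have "bounded (range D)"
    by (meson bounded_insert bounded_subset compact_imp_bounded)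
  with D that show ?thesis by blast
qed

text \<open>The building block of the final vector field: a scalar cutoff times a constant
  direction.\<close>

lemma Theta_space_scaleR:
  fixes \<phi> :: "'a::euclidean_space \<Rightarrow> real" and u :: 'a
  assumes "C1_on_space \<phi>" "compact (closure {x. \<phi> x \<noteq> 0})"
  shows "(\<lambda>x. \<phi> x *\<^sub>R u) \<in> Theta_space"
proof -
  obtain D :: "'a \<Rightarrow> 'a \<Rightarrow>\<^sub>L real" where D: "\<And>x. (\<phi> has_derivative blinfun_apply (D x)) (at x)"
    "continuous_on UNIV D" "bounded (range D)"
    using C1_bounded_derivative[OF assms] by blast
  let ?S = "blinfun_scaleR_left u :: real \<Rightarrow>\<^sub>L 'a"
  have "compact (\<phi> ` closure {x. \<phi> x \<noteq> 0})"
    using assms C1_on_space_imp_continuous_on continuous_on_subset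
    by (intro compact_continuous_image) blast+
  then have "bounded (insert 0 (\<phi> ` closure {x. \<phi> x \<noteq> 0}))"
    by (simp add: compact_imp_bounded)
  moreover have "range \<phi> \<subseteq> insert 0 (\<phi> ` closure {x. \<phi> x \<noteq> 0})"
    using closure_subset by fastforce
  ultimately have "bounded (range \<phi>)" using bounded_subset by blast
  then have "bounded ((\<lambda>t. t *\<^sub>R u) ` range \<phi>)"
    by (rule bounded_linear_image) (rule bounded_linear_scaleR_left)
  moreover have "bounded ((\<lambda>T. ?S o\<^sub>L T) ` range D)"
    by (rule bounded_linear_image[OF D(3)])
       (rule bounded_bilinear.bounded_linear_right[OF bounded_bilinear_blinfun_compose])
  moreover have "((\<lambda>x. \<phi> x *\<^sub>R u) has_derivative blinfun_apply (?S o\<^sub>L D x)) (at x)" for x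
    using has_derivative_scaleR_left[OF D(1), of u x]
    by (rule has_derivative_eq_rhs) (simp add: fun_eq_iff blinfun_scaleR_left.rep_eq)
  moreover have "continuous_on UNIV (\<lambda>x. ?S o\<^sub>L D x)"
    by (intro continuous_intros D)
  ultimately show ?thesis
    unfolding Theta_space_def by (auto simp: image_image intro!: exI[of _ "\<lambda>x. ?S o\<^sub>L D x"])
qed

lemma Theta_space_sum:
  fixes f :: "'i \<Rightarrow> 'a::euclidean_space \<Rightarrow> 'a"
  shows "finite I \<Longrightarrow> (\<And>i. i \<in> I \<Longrightarrow> f i \<in> Theta_space) \<Longrightarrow> (\<lambda>x. \<Sum>i\<in>I. f i x) \<in> Theta_space"
proof (induction I rule: finite_induct)
  case empty
  have "bounded (range (\<lambda>x::'a. 0 :: 'a \<Rightarrow>\<^sub>L 'a))" "bounded (range (\<lambda>x::'a. 0 :: 'a))"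
    by (auto intro: finite_imp_bounded)
  then show ?case
    unfolding Theta_space_def
    by (auto intro!: exI[of _ "\<lambda>x. 0"] simp: zero_blinfun.rep_eq)
next
  case (insert i I)
  have "f i \<in> Theta_space" "(\<lambda>x. \<Sum>i\<in>I. f i x) \<in> Theta_space"
    using insert by auto
  then obtain D D' where "bounded (range (f i))" "bounded (range (\<lambda>x. \<Sum>i\<in>I. f i x))"
    "\<And>x. (f i has_derivative blinfun_apply (D x)) (at x)" "continuous_on UNIV D" "bounded (range D)"
    "\<And>x. ((\<lambda>x. \<Sum>i\<in>I. f i x) has_derivative blinfun_apply (D' x)) (at x)"
    "continuous_on UNIV D'" "bounded (range D')"
    unfolding Theta_space_def by blast
  then show ?case
    unfolding Theta_space_def using insert.hyps
    by (auto simp: plus_blinfun.rep_eq intro!: bounded_plus_comp exI[of _ "\<lambda>x. D x + D' x"]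
        has_derivative_add continuous_intros)
qed

text \<open>A finite sum of bumps centred in \<open>K\<close> is positive on \<open>K\<close>, hence
  bounded below there by some \<open>m > 0\<close>. Composing it with a C1 function that is 0 at 0
  and 1 beyond \<open>m\<close> gives the cutoff.\<close>

lemma C1_Urysohn:
  fixes K G :: "'a::euclidean_space set"
  assumes "compact K" "open G" "K \<subseteq> G"
  obtains \<phi> :: "'a \<Rightarrow> real" where "C1_on_space \<phi>" "\<And>x. 0 \<le> \<phi> x" "\<And>x. \<phi> x \<le> 1"
    "\<And>x. x \<in> K \<Longrightarrow> \<phi> x = 1" "compact (closure {x. \<phi> x \<noteq> 0})" "closure {x. \<phi> x \<noteq> 0} \<subseteq> G"
proof (cases "K = {}")
  case True
  then show ?thesis by (intro that[of "\<lambda>x. 0"] C1_on_space_const) auto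
next
  case False
  obtain \<epsilon> where \<epsilon>: "\<epsilon> > 0" "(\<Union>x\<in>K. cball x \<epsilon>) \<subseteq> G"
    using compact_subset_open_imp_cball_epsilon_subset[OF assms] by blast
  obtain C where C: "C \<subseteq> K" "finite C" "K \<subseteq> (\<Union>x\<in>C. ball x \<epsilon>)"
    using compactE_image[OF assms(1), of K "\<lambda>x. ball x \<epsilon>"] \<epsilon>(1) by force
  define s where "s y = (\<Sum>c\<in>C. bump c \<epsilon> y)" for y
  have C1s: "C1_on_space s"
    unfolding s_def[abs_def] by (intro C1_on_space_sum C1_on_space_bump C)
  have s_nonneg: "s y \<ge> 0" for y
    unfolding s_def by (intro sum_nonneg bump_nonneg)
  have s_pos: "s y > 0" if y: "y \<in> K" for y
  proof -
    obtain c where "c \<in> C" "y \<in> ball c \<epsilon>" using C(3) y by blast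
    then show ?thesis
      unfolding s_def using C bump_pos_iff[OF \<epsilon>(1)] by (intro sum_pos2[of _ c]) (auto intro: bump_nonneg)
  qed
  obtain z where z: "z \<in> K" "\<And>y. y \<in> K \<Longrightarrow> s z \<le> s y"
    using continuous_attains_inf[OF assms(1) False]
      continuous_on_subset[OF C1_on_space_imp_continuous_on[OF C1s]] by blast
  define m where "m = s z"
  have m: "m > 0" using s_pos z by (simp add: m_def)
  \<comment> \<open>As a function of the value \<open>t\<close> of \<open>s\<close>, this is 0 at
    \<open>t = 0\<close>, increases up to \<open>t = m\<close> and equals 1 from there on. It is C1
    because the positive part enters squared.\<close>
  define \<phi> where "\<phi> y = 1 - (max 0 (1 - s y / m))\<^sup>2" for y
  have supp: "closure {x. \<phi> x \<noteq> 0} \<subseteq> (\<Union>c\<in>C. cball c \<epsilon>)"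
  proof (rule closure_minimal)
    have "s x = 0" if "x \<notin> (\<Union>c\<in>C. cball c \<epsilon>)" for x
      unfolding s_def using that \<epsilon> by (intro sum.neutral ballI bump_eq_0) auto
    then show "{x. \<phi> x \<noteq> 0} \<subseteq> (\<Union>c\<in>C. cball c \<epsilon>)"
      by (force simp: \<phi>_def)
    show "closed (\<Union>c\<in>C. cball c \<epsilon>)" using C by auto
  qed
  show ?thesis
  proof
    have "((\<lambda>t. 1 - (max 0 (1 - t / m))\<^sup>2) has_real_derivative 2 * max 0 (1 - t / m) / m) (at t)" for t
    proof -
      have "((\<lambda>t. 1 - t / m) has_real_derivative - 1 / m) (at t)"
        using m by (auto intro!: derivative_eq_intros)
      from DERIV_diff[OF DERIV_const DERIV_chain2[OF has_real_derivative_max_0_power2 this]]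
      show ?thesis by simp
    qed
    then show "C1_on_space \<phi>"
      unfolding \<phi>_def[abs_def]
      by (rule C1_on_space_compose_real[OF C1s]) (use m in \<open>intro continuous_intros, auto\<close>)
    show "0 \<le> \<phi> x" for x
      using m s_nonneg[of x] by (auto simp: \<phi>_def max_def intro!: power_le_one)
    show "\<phi> x \<le> 1" for x by (simp add: \<phi>_def)
    show "\<phi> x = 1" if "x \<in> K" for x
      using z(2)[OF that] m by (simp add: \<phi>_def m_def max_def field_simps)
    show "compact (closure {x. \<phi> x \<noteq> 0})"
      using supp C compact_Int_closed[of "\<Union>c\<in>C. cball c \<epsilon>" "closure {x. \<phi> x \<noteq> 0}"]
      by (metis closed_closure compact_UN compact_cball inf.absorb2)
    show "closure {x. \<phi> x \<noteq> 0} \<subseteq> G"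
      using supp \<epsilon> C(1) by blast
  qed
qed

section \<open>Finite Borel measures\<close>

text \<open>An identity P - M = P' - M' of signed measures is used in the additive form P + M' = P'
  + M, which avoids subtraction in \<open>ennreal\<close>. The identity passes from sets to
  functions by the standard induction on \<open>f\<close>.\<close>

lemma nn_integral_add_measures_cong:
  assumes [measurable_cong]: "sets P = sets N" "sets Q = sets N" "sets P' = sets N" "sets Q' = sets N"
    and eq: "\<And>A. A \<in> sets N \<Longrightarrow> emeasure P A + emeasure Q A = emeasure P' A + emeasure Q' A"
    and f: "f \<in> borel_measurable N"
  shows "(\<integral>\<^sup>+x. f x \<partial>P) + (\<integral>\<^sup>+x. f x \<partial>Q) = (\<integral>\<^sup>+x. f x \<partial>P') + (\<integral>\<^sup>+x. f x \<partial>Q')"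
  using f
proof (induction rule: borel_measurable_induct)
  case (cong f g)
  have "integral\<^sup>N R f = integral\<^sup>N R g" if "sets R = sets N" for R
    using cong(3) sets_eq_imp_space_eq[OF that] by (intro nn_integral_cong) simp
  then show ?case using cong(4) assms(1-4) by simp
next
  case (set A)
  then show ?case using eq assms(1-4) by simp
next
  case (mult u c)
  note [measurable] = mult(2)
  show ?case using mult by (simp add: nn_integral_cmult flip: distrib_left)
next
  case (add u w)
  have split: "(\<integral>\<^sup>+x. w x + u x \<partial>R) = integral\<^sup>N R w + integral\<^sup>N R u" if "sets R = sets N" for R
    using add(1,3) by (intro nn_integral_add) (simp_all add: measurable_cong_sets[OF that refl])
  have swap: "(p + q) + (p' + q') = (p + p') + (q + q')" for p q p' q' :: ennreal
    by (simp add: ac_simps)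
  show ?case
    unfolding split[OF assms(1)] split[OF assms(2)] split[OF assms(3)] split[OF assms(4)]
    by (rule trans[OF swap trans[OF arg_cong2[of _ _ _ _ "(+)"] swap]]) fact+
next
  case (seq U)
  have SUP: "(\<integral>\<^sup>+x. Sup (range U) x \<partial>R) + (\<integral>\<^sup>+x. Sup (range U) x \<partial>S)
      = (SUP i. integral\<^sup>N R (U i) + integral\<^sup>N S (U i))"
    if "sets R = sets N" "sets S = sets N" for R S
  proof -
    have mono: "incseq (\<lambda>i. integral\<^sup>N T (U i))" for T :: "'a measure"
      using \<open>incseq U\<close> by (auto simp: incseq_def le_fun_def intro!: nn_integral_mono)
    have "(\<integral>\<^sup>+x. Sup (range U) x \<partial>T) = (SUP i. integral\<^sup>N T (U i))" if "sets T = sets N" for T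
    proof -
      have "U i \<in> borel_measurable T" for i
        using seq(1) measurable_cong_sets[OF that refl] by blast
      from nn_integral_monotone_convergence_SUP[OF \<open>incseq U\<close> this] show ?thesis
        by (simp add: image_comp)
    qed
    then show ?thesis using that ennreal_SUP_add[OF mono mono] by presburger
  qed
  show ?case
    unfolding SUP[OF assms(1,2)] SUP[OF assms(3,4)] by (intro SUP_cong refl) (rule seq)
qed

text \<open>Two decompositions of the same signed measure satisfy P + M' = P' + M on Borel sets, so
  the integrals satisfy the same relation; all of them are finite because \<open>f\<close> is
  bounded.\<close>

lemma has_signed_integral_eq:
  assumes PM: "finite_measure P" "finite_measure M" "sets P = sets borel" "sets M = sets borel"
    "\<And>A. A \<in> sets borel \<Longrightarrow> m A = measure P A - measure M A"
    and f: "f \<in> borel_measurable borel" "\<And>x. 0 \<le> f x" "\<And>x. f x \<le> c"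
    and I: "has_signed_integral m f I"
  shows "I = integral\<^sup>L P f - integral\<^sup>L M f"
proof -
  obtain P' M' where PM': "finite_measure P'" "finite_measure M'" "sets P' = sets borel"
    "sets M' = sets borel" "\<And>A. A \<in> sets borel \<Longrightarrow> m A = measure P' A - measure M' A"
    and I: "I = integral\<^sup>L P' f - integral\<^sup>L M' f"
    using I unfolding has_signed_integral_def by blast
  have int: "(\<integral>\<^sup>+x. ennreal (f x) \<partial>R) = ennreal (integral\<^sup>L R f)"
    if "finite_measure R" "sets R = sets borel" for R
  proof (rule nn_integral_eq_integral)
    have "f \<in> borel_measurable R" using f(1) that(2) measurable_cong_sets by blast
    then show "integrable R f"
      using f that by (intro finite_measure.integrable_const_bound[where B = c]) auto
  qed (use f in auto)
  have "(\<integral>\<^sup>+x. ennreal (f x) \<partial>P) + (\<integral>\<^sup>+x. ennreal (f x) \<partial>M')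
      = (\<integral>\<^sup>+x. ennreal (f x) \<partial>P') + (\<integral>\<^sup>+x. ennreal (f x) \<partial>M)"
  proof (rule nn_integral_add_measures_cong)
    fix A assume "A \<in> sets (borel :: 'a measure)"
    then have "measure P A + measure M' A = measure P' A + measure M A"
      using PM(5)[of A] PM'(5)[of A] by simp
    then show "emeasure P A + emeasure M' A = emeasure P' A + emeasure M A"
      using PM PM' by (simp add: finite_measure.emeasure_eq_measure flip: ennreal_plus)
  qed (use PM PM' f in auto)
  moreover have "integral\<^sup>L R f \<ge> 0" for R using f by simp
  ultimately have "integral\<^sup>L P f + integral\<^sup>L M' f = integral\<^sup>L P' f + integral\<^sup>L M f"
    using PM PM' int by (simp flip: ennreal_plus)
  then show ?thesis using I by simp
qed

text \<open>\<open>distributional_gradient_of_indicator\<close> lets the decomposition vary with the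
  test function. Here one pair is fixed that serves all test functions with values between 0 and
  1.\<close>

lemma gradient_component_decomposition:
  fixes E :: "'a::euclidean_space set"
  assumes "distributional_gradient_of_indicator E \<mu>" "b \<in> Basis"
  obtains P M where "finite_measure P" "finite_measure M" "sets P = sets borel" "sets M = sets borel"
    "\<And>A. A \<in> sets borel \<Longrightarrow> \<mu> A \<bullet> b = measure P A - measure M A"
    "\<And>\<phi>. \<lbrakk>C1_on_space \<phi>; compact (closure {x. \<phi> x \<noteq> 0}); \<And>x. 0 \<le> \<phi> x; \<And>x. \<phi> x \<le> (1::real)\<rbrakk> \<Longrightarrow>
       integral\<^sup>L P \<phi> - integral\<^sup>L M \<phi> = - (LINT x:E|lebesgue. frechet_derivative \<phi> (at x) b)"
proof -
  have *: "has_signed_integral (\<lambda>A. \<mu> A \<bullet> b) \<phi> (- (LINT x:E|lebesgue. frechet_derivative \<phi> (at x) b))"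
    if "C1_on_space \<phi>" "compact (closure {x. \<phi> x \<noteq> 0})" for \<phi> :: "'a \<Rightarrow> real"
    using assms that unfolding distributional_gradient_of_indicator_def by blast
  obtain P M where PM: "finite_measure P" "finite_measure M" "sets P = sets borel" "sets M = sets borel"
    "\<And>A. A \<in> sets borel \<Longrightarrow> \<mu> A \<bullet> b = measure P A - measure M A"
    \<comment> \<open>The zero function is an admissible test function, and its integral already
      supplies a decomposition of the measure.\<close>
    using *[OF C1_on_space_const[of 0]] unfolding has_signed_integral_def by auto
  show ?thesis
  proof (rule that[OF PM])
    fix \<phi> :: "'a \<Rightarrow> real"
    assume \<phi>: "C1_on_space \<phi>" "compact (closure {x. \<phi> x \<noteq> 0})" "\<And>x. 0 \<le> \<phi> x" "\<And>x. \<phi> x \<le> 1"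
    have "\<phi> \<in> borel_measurable borel"
      by (intro borel_measurable_continuous_onI C1_on_space_imp_continuous_on \<phi>)
    from has_signed_integral_eq[OF PM this \<phi>(3,4) *[OF \<phi>(1,2)]]
    show "integral\<^sup>L P \<phi> - integral\<^sup>L M \<phi> = - (LINT x:E|lebesgue. frechet_derivative \<phi> (at x) b)"
      by simp
  qed
qed

lemma finite_borel_measure_inner_compact:
  fixes P :: "'a::euclidean_space measure"
  assumes "finite_measure P" "sets P = sets borel" "A \<in> sets borel" "\<epsilon> > 0"
  obtains K where "compact K" "K \<subseteq> A" "measure P (A - K) < \<epsilon>"
proof -
  interpret finite_measure P by fact
  show ?thesis
  proof (cases "measure P A < \<epsilon>")
    case True
    then show ?thesis by (intro that[of "{}"]) auto
  next
    case False
    \<comment> \<open>In this case the difference is nonnegative, so \<open>ennreal\<close> does not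
      truncate it.\<close>
    have "ennreal (measure P A - \<epsilon>) < emeasure P A"
      using False assms(4) by (simp add: emeasure_eq_measure ennreal_lessI)
    also have "\<dots> = (SUP K \<in> {K. K \<subseteq> A \<and> compact K}. emeasure P K)"
      using assms by (intro inner_regular) auto
    finally obtain K where K: "K \<subseteq> A" "compact K" "ennreal (measure P A - \<epsilon>) < emeasure P K"
      unfolding less_SUP_iff by blast
    then have "measure P A - \<epsilon> < measure P K"
      using False by (simp add: emeasure_eq_measure ennreal_less_iff)
    moreover have "K \<in> sets P" using K(2) assms(2) by (simp add: borel_compact)
    then have "measure P (A - K) = measure P A - measure P K"
      using K assms by (intro finite_measure_Diff) auto
    ultimately show ?thesis using K by (intro that[of K]) auto
  qed
qed

lemma finite_borel_measures_regular:
  fixes \<P> :: "'a::euclidean_space measure set"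
  assumes \<P>: "finite \<P>" "\<And>P. P \<in> \<P> \<Longrightarrow> finite_measure P \<and> sets P = sets borel"
    and A: "A \<in> sets borel" "A \<subseteq> B" "open B" "\<epsilon> > 0"
  obtains K G where "compact K" "open G" "K \<subseteq> A" "A \<subseteq> G" "G \<subseteq> B"
    "\<And>P. P \<in> \<P> \<Longrightarrow> measure P (G - K) < \<epsilon>"
proof -
  \<comment> \<open>The outer approximation of \<open>A\<close> comes from an inner approximation of its complement.\<close>
  have "\<exists>K. compact K \<and> K \<subseteq> A' \<and> measure P (A' - K) < \<epsilon> / 2"
    if P: "P \<in> \<P>" and A': "A' \<in> sets borel" for P A'
  proof -
    have "\<epsilon> / 2 > 0" using A(4) by simp
    then obtain K where "compact K" "K \<subseteq> A'" "measure P (A' - K) < \<epsilon> / 2"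
      using finite_borel_measure_inner_compact \<P>(2)[OF P] A' by metis
    then show ?thesis by blast
  qed
  then obtain k where k: "\<And>P A'. P \<in> \<P> \<Longrightarrow> A' \<in> sets borel \<Longrightarrow>
      compact (k P A') \<and> k P A' \<subseteq> A' \<and> measure P (A' - k P A') < \<epsilon> / 2"
    by metis
  have A': "- A \<in> sets borel" using A by auto
  \<comment> \<open>Unions over the finite family stay compact and approximate for all measures at
    once.\<close>
  define K K' where "K = (\<Union>P\<in>\<P>. k P A)" and "K' = (\<Union>P\<in>\<P>. k P (- A))"
  have c: "compact K" "compact K'"
    unfolding K_def K'_def using \<P>(1) k A(1) A' by (intro compact_UN; auto)+
  show ?thesis
  proof
    show "compact K" by fact
    show "open (B - K')" using A c by (simp add: compact_imp_closed open_Diff)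
    show "K \<subseteq> A" using k A(1) by (auto simp: K_def)
    have "k P (- A) \<subseteq> - A" if "P \<in> \<P>" for P using k[OF that A'] by simp
    then have "K' \<subseteq> - A" unfolding K'_def by (rule UN_least)
    then show "A \<subseteq> B - K'" using A(2) by blast
    show "B - K' \<subseteq> B" by blast
    fix P assume P: "P \<in> \<P>"
    interpret finite_measure P using \<P> P by blast
    have S: "sets P = sets borel" using \<P> P by blast
    have [simp]: "k P A \<in> sets borel" "k P (- A) \<in> sets borel"
      using k[OF P A(1)] k[OF P A'] by (simp_all add: borel_compact)
    \<comment> \<open>A point of the gap lies either in \<open>A\<close> but not in
      \<open>k P A\<close>, or in \<open>- A\<close> but not in \<open>k P (- A)\<close>; each part
      has measure below \<epsilon> / 2.\<close>
    have "measure P ((B - K') - K) \<le> measure P ((A - k P A) \<union> (- A - k P (- A)))"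
      using P A(1) A' unfolding S by (intro finite_measure_mono) (auto simp: K_def K'_def S intro!: sets.Un sets.Diff)
    also have "\<dots> \<le> measure P (A - k P A) + measure P (- A - k P (- A))"
      using A A' by (intro measure_Un_le) (auto simp: S intro!: sets.Diff)
    also have "\<dots> < \<epsilon>" using k[OF P A(1)] k[OF P A'] by simp
    finally show "measure P ((B - K') - K) < \<epsilon>" .
  qed
qed

text \<open>The function and the indicator of \<open>A\<close> agree on \<open>K\<close> and off
  \<open>G\<close>, and differ by at most 1 in between.\<close>

lemma integral_between_indicators:
  assumes "finite_measure P" and [measurable_cong]: "sets P = sets borel"
    and [measurable]: "K \<in> sets borel" "A \<in> sets borel" "G \<in> sets borel"
    and "K \<subseteq> A" "A \<subseteq> G"
    and [measurable]: "\<phi> \<in> borel_measurable borel"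
    and \<phi>: "\<And>x. 0 \<le> \<phi> x" "\<And>x. \<phi> x \<le> (1::real)" "\<And>x. x \<in> K \<Longrightarrow> \<phi> x = 1"
      "\<And>x. x \<notin> G \<Longrightarrow> \<phi> x = 0"
  shows "\<bar>integral\<^sup>L P \<phi> - measure P A\<bar> \<le> measure P (G - K)"
proof -
  interpret finite_measure P by fact
  have sp: "space P = space borel" using assms(2) by (rule sets_eq_imp_space_eq)
  have int: "integrable P \<phi>"
    using \<phi> by (intro integrable_const_bound[where B = 1]) auto
  have iA: "integrable P (indicat_real A)" and iGK: "integrable P (indicat_real (G - K))"
    by (auto intro!: integrable_const_bound[where B = 1] simp: indicator_def)
  have "integral\<^sup>L P \<phi> - measure P A = (\<integral>x. \<phi> x - indicator A x \<partial>P)"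
    using int iA by (simp add: sp)
  also have "\<bar>\<dots>\<bar> \<le> (\<integral>x. indicator (G - K) x \<partial>P)"
  proof (rule order_trans[OF integral_abs_bound integral_mono])
    show "\<bar>\<phi> x - indicator A x\<bar> \<le> indicator (G - K) x" for x
      using \<phi>(1,2)[of x] \<phi>(3,4)[of x] assms(6,7) by (auto simp: indicator_def)
  qed (use int iA iGK in auto)
  also have "\<dots> = measure P (G - K)" by (simp add: sp)
  finally show ?thesis .
qed

section \<open>The gradient of an indicator function\<close>

lemma integral_lborel_translation:
  fixes f :: "'a::euclidean_space \<Rightarrow> real"
  assumes "integrable lborel f"
  shows "integrable lborel (\<lambda>x. f (c + x))" "(\<integral>x. f (c + x) \<partial>lborel) = (\<integral>x. f x \<partial>lborel)"
proof -
  have f: "f \<in> borel_measurable borel" using assms by auto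
  have m: "(+) c \<in> lborel \<rightarrow>\<^sub>M borel" by simp
  show "integrable lborel (\<lambda>x. f (c + x))"
    using integrable_distr_eq[OF m f] assms by (simp add: lborel_distr_plus)
  show "(\<integral>x. f (c + x) \<partial>lborel) = (\<integral>x. f x \<partial>lborel)"
    using integral_distr[OF m f] by (simp add: lborel_distr_plus)
qed

lemma integrable_indicator_mult_continuous:
  fixes h :: "'a::euclidean_space \<Rightarrow> real"
  assumes "open E" "bounded E" "continuous_on UNIV h"
  shows "integrable lborel (\<lambda>x. indicator E x * h x)"
proof -
  have "compact (closure E)" using assms by simp
  moreover have "continuous_on (closure E) h" using assms continuous_on_subset by blast
  ultimately have "set_integrable lborel (closure E) h"
    unfolding set_integrable_def by (rule borel_integrable_compact)
  then have "set_integrable lborel E h"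
    by (rule set_integrable_subset) (use assms closure_subset in auto)
  then show ?thesis by (simp add: set_integrable_def)
qed

lemma set_lebesgue_integral_lebesgue_continuous:
  fixes h :: "'a::euclidean_space \<Rightarrow> real"
  assumes "open E" "continuous_on UNIV h"
  shows "(LINT x:E|lebesgue. h x) = (\<integral>x. indicator E x * h x \<partial>lborel)"
proof -
  have "h \<in> borel_measurable borel" "E \<in> sets borel"
    using assms by (auto intro: borel_measurable_continuous_onI)
  then have "(\<lambda>x. indicator E x * h x) \<in> borel_measurable lborel" by simp
  from integral_completion[OF this] show ?thesis
    by (simp add: set_lebesgue_integral_def)
qed

text \<open>The directional derivative is the limit of difference quotients along \<open>v\<close>.
  Each quotient has nonnegative integral over \<open>E\<close>, because moving by
  \<open>- t v\<close> keeps the part of \<open>E\<close> in the support inside \<open>E\<close>;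
  dominated convergence passes to the limit.\<close>

lemma set_integral_directional_derivative_nonneg:
  fixes \<phi> :: "'a::euclidean_space \<Rightarrow> real"
  assumes \<phi>: "C1_on_space \<phi>" "compact (closure {x. \<phi> x \<noteq> 0})" "\<And>x. 0 \<le> \<phi> x"
    and E: "open E" "bounded E"
    and B: "open B" "closure {x. \<phi> x \<noteq> 0} \<subseteq> B"
    and down: "\<And>y t. \<lbrakk>y \<in> B; y \<in> E; t > 0; y - t *\<^sub>R v \<in> B\<rbrakk> \<Longrightarrow> y - t *\<^sub>R v \<in> E"
  shows "0 \<le> (LINT x:E|lebesgue. frechet_derivative \<phi> (at x) v)"
proof -
  obtain D where D: "\<And>x. (\<phi> has_derivative blinfun_apply (D x)) (at x)" "continuous_on UNIV D"
    "bounded (range D)"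
    using C1_bounded_derivative[OF \<phi>(1,2)] by blast
  obtain C where C: "\<And>x. norm (D x) \<le> C" using D(3) by (auto simp: bounded_iff)
  have [simp]: "frechet_derivative \<phi> (at x) = blinfun_apply (D x)" for x
    using frechet_derivative_at[OF D(1)] by simp
  have cD: "continuous_on UNIV (\<lambda>x. D x v)" by (intro continuous_intros D)
  have c\<phi>: "continuous_on UNIV \<phi>" using \<phi>(1) by (rule C1_on_space_imp_continuous_on)
  obtain \<epsilon> where \<epsilon>: "\<epsilon> > 0" "(\<Union>x\<in>closure {x. \<phi> x \<noteq> 0}. ball x \<epsilon>) \<subseteq> B"
    using compact_subset_open_imp_ball_epsilon_subset[OF \<phi>(2) B] by blast
  \<comment> \<open>Shifts by at most \<open>\<delta>\<close> times \<open>v\<close> keep the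
    support inside \<open>B\<close>; the summand 1 covers \<open>v = 0\<close>.\<close>
  define \<delta> where "\<delta> = \<epsilon> / (1 + norm v)"
  have \<delta>: "\<delta> > 0" "\<delta> * norm v < \<epsilon>"
    using \<epsilon> by (auto simp: \<delta>_def field_simps add_pos_nonneg)
  define \<tau> where "\<tau> n = \<delta> * inverse (real (Suc n))" for n
  have \<tau>: "\<tau> n > 0" "\<tau> n \<le> \<delta>" for n
    using \<delta> by (auto simp: \<tau>_def field_simps)
  have "\<tau> \<longlonglongrightarrow> \<delta> * 0"
    unfolding \<tau>_def by (intro tendsto_intros LIMSEQ_inverse_real_of_nat)
  then have \<tau>0: "filterlim \<tau> (at 0) sequentially"
    using \<tau> by (intro filterlim_atI) (auto simp: less_imp_neq[symmetric] intro!: always_eventually)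
  define F where "F n x = indicator E x * ((\<phi> (x + \<tau> n *\<^sub>R v) - \<phi> x) / \<tau> n)" for n x
  \<comment> \<open>Translating the variable moves the difference quotient from \<open>\<phi>\<close> to the indicator of \<open>E\<close>.\<close>
  have F_nonneg: "0 \<le> (\<integral>x. F n x \<partial>lborel)" for n
  proof -
    let ?t = "\<tau> n"
    let ?f = "\<lambda>x. indicator E x * \<phi> (x + ?t *\<^sub>R v)"
    have if1: "integrable lborel ?f"
      by (intro integrable_indicator_mult_continuous E continuous_intros 
          continuous_on_compose2[OF c\<phi>]) auto
    have if2: "integrable lborel (\<lambda>x. indicator E x * \<phi> x)"
      by (intro integrable_indicator_mult_continuous E c\<phi>)
    have tr: "integrable lborel (\<lambda>x. indicator E (x - ?t *\<^sub>R v) * \<phi> x)"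
      "(\<integral>x. indicator E (x - ?t *\<^sub>R v) * \<phi> x \<partial>lborel) = (\<integral>x. ?f x \<partial>lborel)"
      using integral_lborel_translation[OF if1, of "- (?t *\<^sub>R v)"] by simp_all
    have "(\<integral>x. indicator E x * \<phi> x \<partial>lborel) \<le> (\<integral>x. indicator E (x - ?t *\<^sub>R v) * \<phi> x \<partial>lborel)"
    proof (rule integral_mono[OF if2 tr(1)])
      fix x
      show "indicator E x * \<phi> x \<le> indicator E (x - ?t *\<^sub>R v) * \<phi> x"
      proof (cases "\<phi> x \<noteq> 0 \<and> x \<in> E")
        case True
        then have x: "x \<in> closure {x. \<phi> x \<noteq> 0}" by (intro subsetD[OF closure_subset]) simp
        have "norm (?t *\<^sub>R v) \<le> \<delta> * norm v"
          using \<tau>[of n] by (simp add: mult_right_mono)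
        then have "x - ?t *\<^sub>R v \<in> ball x \<epsilon>" using \<delta> by (simp add: dist_norm)
        then have "x - ?t *\<^sub>R v \<in> E"
          using down[of x ?t] x \<epsilon>(2) B(2) True \<tau> by blast
        then show ?thesis using True by simp
      qed (use \<phi>(3)[of x] in \<open>auto simp: indicator_def\<close>)
    qed
    then have "0 \<le> (\<integral>x. ?f x - indicator E x * \<phi> x \<partial>lborel) / ?t"
      using tr(2) if1 if2 \<tau>[of n] by (simp add: less_imp_le)
    also have "\<dots> = (\<integral>x. (?f x - indicator E x * \<phi> x) / ?t \<partial>lborel)"
      by simp
    also have "\<dots> = (\<integral>x. F n x \<partial>lborel)"
      by (simp add: F_def field_simps)
    finally show ?thesis .
  qed
  have "(\<lambda>n. \<integral>x. F n x \<partial>lborel) \<longlonglongrightarrow> (\<integral>x. indicator E x * D x v \<partial>lborel)"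
  \<comment> \<open>The mean value inequality bounds every quotient by \<open>C * norm v\<close>,
    which is integrable over the bounded set \<open>E\<close>.\<close>
  proof (rule integral_dominated_convergence[where w = "\<lambda>x. indicator E x * (C * norm v)"])
    show "integrable lborel (\<lambda>x. indicator E x * (C * norm v))"
      by (intro integrable_indicator_mult_continuous E continuous_intros)
    show "(\<lambda>x. indicator E x * D x v) \<in> borel_measurable lborel"
      using integrable_indicator_mult_continuous[OF E cD] by auto
    show "F n \<in> borel_measurable lborel" for n
    proof -
      have "continuous_on UNIV (\<lambda>x. (\<phi> (x + \<tau> n *\<^sub>R v) - \<phi> x) / \<tau> n)"
        using \<tau>(1)[of n] by (intro continuous_intros continuous_on_compose2[OF c\<phi>]) auto
      from integrable_indicator_mult_continuous[OF E this] show ?thesis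
        by (auto simp: F_def[abs_def])
    qed
    show "AE x in lborel. (\<lambda>n. F n x) \<longlonglongrightarrow> indicator E x * D x v"
    proof (intro always_eventually allI)
      fix x
      have "((\<lambda>t. x + t *\<^sub>R v) has_derivative (\<lambda>t. t *\<^sub>R v)) (at 0)"
        by (auto intro!: derivative_eq_intros)
      moreover have "(\<phi> has_derivative blinfun_apply (D x)) (at (x + 0 *\<^sub>R v))" using D(1) by simp
      ultimately have "((\<lambda>t. \<phi> (x + t *\<^sub>R v)) has_derivative (\<lambda>t. D x (t *\<^sub>R v))) (at 0)"
        by (rule has_derivative_compose)
      then have "((\<lambda>t. \<phi> (x + t *\<^sub>R v)) has_real_derivative D x v) (at 0)"
        unfolding has_field_derivative_def
        by (rule has_derivative_eq_rhs) (simp add: fun_eq_iff blinfun.scaleR_right mult.commute)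
      then have "((\<lambda>t. (\<phi> (x + t *\<^sub>R v) - \<phi> x) / t) \<longlongrightarrow> D x v) (at 0)"
        by (simp add: DERIV_def)
      from filterlim_compose[OF this \<tau>0]
      show "(\<lambda>n. F n x) \<longlonglongrightarrow> indicator E x * D x v"
        unfolding F_def by (intro tendsto_intros)
    qed
    show "AE x in lborel. norm (F n x) \<le> indicator E x * (C * norm v)" for n
    proof (intro always_eventually allI)
      fix x
      have "norm (\<phi> (x + \<tau> n *\<^sub>R v) - \<phi> x) \<le> C * norm ((x + \<tau> n *\<^sub>R v) - x)"
        by (rule differentiable_bound[where S = UNIV and f' = "\<lambda>x. blinfun_apply (D x)"])
           (use D(1) C in \<open>auto simp: norm_blinfun.rep_eq[symmetric]\<close>)
      then have "\<bar>\<phi> (x + \<tau> n *\<^sub>R v) - \<phi> x\<bar> / \<tau> n \<le> C * norm v"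
        using \<tau>(1)[of n] by (simp add: field_simps)
      then show "norm (F n x) \<le> indicator E x * (C * norm v)"
        using \<tau>(1)[of n] by (auto simp: F_def indicator_def abs_mult)
    qed
  qed
  then have "0 \<le> (\<integral>x. indicator E x * D x v \<partial>lborel)"
    using F_nonneg by (intro LIMSEQ_le_const) auto
  then show ?thesis
    using set_lebesgue_integral_lebesgue_continuous[OF E(1) cD] by simp
qed

text \<open>For a cutoff supported in \<open>B\<close>, integrating it against the \<open>v\<close>
  component of the gradient gives minus the integral of its derivative along \<open>v\<close> over
  \<open>E\<close>, hence a nonpositive number. Regularity of the measures replaces the indicator of
  \<open>A\<close> by such a cutoff up to a small error.\<close>

lemma gradient_inner_nonpos:
  fixes E :: "'a::euclidean_space set"
  assumes E: "open E" "bounded E" and \<mu>: "distributional_gradient_of_indicator E \<mu>"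
    and B: "open B" and A: "A \<in> sets borel" "A \<subseteq> B"
    and down: "\<And>y t. \<lbrakk>y \<in> B; y \<in> E; t > 0; y - t *\<^sub>R v \<in> B\<rbrakk> \<Longrightarrow> y - t *\<^sub>R v \<in> E"
  shows "\<mu> A \<bullet> v \<le> 0"
proof -
  \<comment> \<open>Bundling these properties into one predicate lets \<open>P\<close> and
    \<open>M\<close> be chosen simultaneously for all basis vectors.\<close>
  define decomposes where "decomposes b P M \<longleftrightarrow>
      finite_measure P \<and> finite_measure M \<and> sets P = sets borel \<and> sets M = sets borel \<and>
      (\<forall>A \<in> sets borel. \<mu> A \<bullet> b = measure P A - measure M A) \<and>
      (\<forall>\<phi> :: 'a \<Rightarrow> real. C1_on_space \<phi> \<longrightarrow> compact (closure {x. \<phi> x \<noteq> 0}) \<longrightarrow>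
        (\<forall>x. 0 \<le> \<phi> x) \<longrightarrow> (\<forall>x. \<phi> x \<le> 1) \<longrightarrow>
        integral\<^sup>L P \<phi> - integral\<^sup>L M \<phi> = - (LINT x:E|lebesgue. frechet_derivative \<phi> (at x) b))"
    for b P M
  have "\<exists>P M. decomposes b P M" if "b \<in> Basis" for b
    by (rule gradient_component_decomposition[OF \<mu> that]) (unfold decomposes_def, blast)
  then obtain P M where PM: "\<And>b. b \<in> Basis \<Longrightarrow> decomposes b (P b) (M b)"
    by metis
  have fin: "finite_measure (P b)" "finite_measure (M b)" "sets (P b) = sets borel" "sets (M b) = sets borel"
    if "b \<in> Basis" for b
    using PM[OF that] by (simp_all add: decomposes_def)
  have \<mu>_eq: "\<mu> A \<bullet> b = measure (P b) A - measure (M b) A" if "b \<in> Basis" "A \<in> sets borel" for b A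
    using PM[OF that(1)] that(2) by (simp add: decomposes_def)
  have grad: "integral\<^sup>L (P b) \<phi> - integral\<^sup>L (M b) \<phi> = - (LINT x:E|lebesgue. frechet_derivative \<phi> (at x) b)"
    if "b \<in> Basis" "C1_on_space \<phi>" "compact (closure {x. \<phi> x \<noteq> 0})" "\<And>x. 0 \<le> \<phi> x" "\<And>x. \<phi> x \<le> 1"
    for b and \<phi> :: "'a \<Rightarrow> real"
  proof -
    have "\<forall>x. 0 \<le> \<phi> x" "\<forall>x. \<phi> x \<le> 1" using that by simp_all
    then show ?thesis using PM[OF that(1)] that(2,3) unfolding decomposes_def by blast
  qed
  define S where "S = (\<Sum>b\<in>Basis. \<bar>v \<bullet> b\<bar>)"
  \<comment> \<open>Each component costs one \<epsilon> for \<open>P b\<close> and one for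
    \<open>M b\<close>, weighted by the coordinate of \<open>v\<close>.\<close>
  have approx: "\<mu> A \<bullet> v \<le> 2 * \<epsilon> * S" if "\<epsilon> > 0" for \<epsilon>
  proof -
    obtain K G where KG: "compact K" "open G" "K \<subseteq> A" "A \<subseteq> G" "G \<subseteq> B"
      and small: "\<And>R. R \<in> P ` Basis \<union> M ` Basis \<Longrightarrow> measure R (G - K) < \<epsilon>"
      by (rule finite_borel_measures_regular[OF _ _ A B \<open>\<epsilon> > 0\<close>, of "P ` Basis \<union> M ` Basis"])
         (use fin in auto)
    obtain \<phi> :: "'a \<Rightarrow> real" where \<phi>: "C1_on_space \<phi>" "\<And>x. 0 \<le> \<phi> x" "\<And>x. \<phi> x \<le> 1"
      "\<And>x. x \<in> K \<Longrightarrow> \<phi> x = 1" "compact (closure {x. \<phi> x \<noteq> 0})" "closure {x. \<phi> x \<noteq> 0} \<subseteq> G"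
      using C1_Urysohn[OF KG(1,2)] KG(3,4) by auto
    have outside: "\<phi> x = 0" if "x \<notin> G" for x
      using subsetD[OF subset_trans[OF closure_subset \<phi>(6)], of x] that by auto
    have m\<phi>: "\<phi> \<in> borel_measurable borel"
      by (intro borel_measurable_continuous_onI C1_on_space_imp_continuous_on \<phi>)
    have close: "\<bar>integral\<^sup>L R \<phi> - measure R A\<bar> \<le> \<epsilon>" if "R \<in> P ` Basis \<union> M ` Basis" for R
    proof -
      have "\<bar>integral\<^sup>L R \<phi> - measure R A\<bar> \<le> measure R (G - K)"
        by (rule integral_between_indicators)
           (use fin that KG A \<phi> m\<phi> outside in \<open>auto simp: borel_compact\<close>)
      then show ?thesis using small[OF that] by simp
    qed
    obtain D where D: "\<And>x. (\<phi> has_derivative blinfun_apply (D x)) (at x)" "continuous_on UNIV D"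
      using \<phi>(1) unfolding C1_on_space_def by blast
    have fd: "frechet_derivative \<phi> (at x) = blinfun_apply (D x)" for x
      using frechet_derivative_at[OF D(1)] by simp
    have cD: "continuous_on UNIV (\<lambda>x. D x w)" for w by (intro continuous_intros D)
    have lint: "(LINT x:E|lebesgue. frechet_derivative \<phi> (at x) w) = (\<integral>x. indicator E x * D x w \<partial>lborel)" for w
      unfolding fd by (rule set_lebesgue_integral_lebesgue_continuous[OF E(1) cD])
    have "0 \<le> (LINT x:E|lebesgue. frechet_derivative \<phi> (at x) v)"
      by (rule set_integral_directional_derivative_nonneg[OF \<phi>(1,5,2) E B]) (use \<phi>(6) KG(5) down in auto)
    \<comment> \<open>The sign is known along \<open>v\<close>, whereas the gradient is tested along
      basis vectors; linearity of the derivative links the two.\<close>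
    also have "\<dots> = (\<integral>x. (\<Sum>b\<in>Basis. (v \<bullet> b) * (indicator E x * D x b)) \<partial>lborel)"
    proof -
      have "D x v = (\<Sum>b\<in>Basis. (v \<bullet> b) * D x b)" for x
        by (subst euclidean_representation[of v, symmetric])
           (simp only: blinfun.sum_right blinfun.scaleR_right real_scaleR_def)
      then show ?thesis unfolding lint by (simp add: sum_distrib_left ac_simps)
    qed
    also have "\<dots> = (\<Sum>b\<in>Basis. (v \<bullet> b) * (LINT x:E|lebesgue. frechet_derivative \<phi> (at x) b))"
      unfolding lint using integrable_indicator_mult_continuous[OF E cD]
      by (subst Bochner_Integration.integral_sum) auto
    also have "\<dots> = - (\<Sum>b\<in>Basis. (v \<bullet> b) * (integral\<^sup>L (P b) \<phi> - integral\<^sup>L (M b) \<phi>))"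
      using grad \<phi> by (simp add: sum_negf)
    finally have neg: "(\<Sum>b\<in>Basis. (v \<bullet> b) * (integral\<^sup>L (P b) \<phi> - integral\<^sup>L (M b) \<phi>)) \<le> 0" by simp
    have "\<mu> A \<bullet> v = (\<Sum>b\<in>Basis. (v \<bullet> b) * (measure (P b) A - measure (M b) A))"
      using A(1) by (subst euclidean_inner) (simp add: \<mu>_eq mult.commute)
    also have "\<dots> \<le> (\<Sum>b\<in>Basis. (v \<bullet> b) * (integral\<^sup>L (P b) \<phi> - integral\<^sup>L (M b) \<phi>) + 2 * \<epsilon> * \<bar>v \<bullet> b\<bar>)"
    proof (rule sum_mono)
      fix b :: 'a assume b: "b \<in> Basis"
      let ?d = "(measure (P b) A - measure (M b) A) - (integral\<^sup>L (P b) \<phi> - integral\<^sup>L (M b) \<phi>)"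
      have "\<bar>?d\<bar> \<le> 2 * \<epsilon>"
        using close[of "P b"] close[of "M b"] b by (simp add: abs_le_iff)
      then have "\<bar>v \<bullet> b\<bar> * \<bar>?d\<bar> \<le> \<bar>v \<bullet> b\<bar> * (2 * \<epsilon>)" by (rule mult_left_mono) simp
      moreover have "(v \<bullet> b) * ?d \<le> \<bar>v \<bullet> b\<bar> * \<bar>?d\<bar>"
        by (metis abs_ge_self abs_mult)
      ultimately show "(v \<bullet> b) * (measure (P b) A - measure (M b) A)
          \<le> (v \<bullet> b) * (integral\<^sup>L (P b) \<phi> - integral\<^sup>L (M b) \<phi>) + 2 * \<epsilon> * \<bar>v \<bullet> b\<bar>"
        by (simp add: algebra_simps)
    qed
    also have "\<dots> \<le> 2 * \<epsilon> * S"
      using neg by (simp add: sum.distrib S_def sum_distrib_left)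
    finally show ?thesis .
  qed
  have S: "S \<ge> 0" unfolding S_def by (intro sum_nonneg) simp
  show ?thesis
  proof (rule field_le_epsilon)
    fix d :: real assume "d > 0"
    \<comment> \<open>The choice of \<epsilon> uses \<open>S + 1\<close> since \<open>S\<close> is 0
      when \<open>v = 0\<close>.\<close>
    then have "\<mu> A \<bullet> v \<le> 2 * (d / (2 * (S + 1))) * S" using S by (intro approx) auto
    also have "\<dots> = d * (S / (S + 1))" using S by (simp add: field_simps)
    also have "\<dots> \<le> d * 1" using S \<open>d > 0\<close> by (intro mult_left_mono) (auto simp: field_simps)
    finally show "\<mu> A \<bullet> v \<le> 0 + d" by simp
  qed
qed

section \<open>From a cone of directions to the outer normal\<close>

text \<open>The extremal direction is the point of the ball around \<open>u\<close> lying farthest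
  along \<open>m\<close>, namely \<open>u\<close> plus \<open>c\<close> times the unit vector of
  \<open>m\<close>.\<close>

lemma norm_le_of_cone_nonpos:
  fixes m u :: "'a::real_inner"
  assumes "c > 0" "\<And>v. norm (v - u) \<le> c \<Longrightarrow> m \<bullet> v \<le> 0"
  shows "c * norm m \<le> - (m \<bullet> u)"
proof (cases "m = 0")
  case False
  have "m \<bullet> (u + (c / norm m) *\<^sub>R m) \<le> 0"
    using assms False by (intro assms(2)) simp
  then have "m \<bullet> u + c / norm m * (m \<bullet> m) \<le> 0" by (simp add: inner_add_right)
  moreover have "c / norm m * (m \<bullet> m) = c * norm m"
    using False by (simp add: dot_square_norm power2_eq_square)
  ultimately show ?thesis by simp
qed simp

text \<open>The upper bound for the norm is linear in \<open>\<mu> A\<close>, so summing it over a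
  partition of \<open>B\<close> gives the value on \<open>B\<close> by countable additivity.\<close>

lemma total_variation_le:
  fixes \<mu> :: "'a::euclidean_space set \<Rightarrow> 'b::euclidean_space"
  assumes \<mu>: "vector_measure \<mu>" and c: "c > 0"
    and le: "\<And>A. A \<in> sets borel \<Longrightarrow> A \<subseteq> B \<Longrightarrow> c * norm (\<mu> A) \<le> - (\<mu> A \<bullet> u)"
  shows "total_variation \<mu> B \<le> ennreal (- (\<mu> B \<bullet> u) / c)"
  unfolding total_variation_def
proof (rule SUP_least)
  fix A :: "nat \<Rightarrow> 'a set"
  assume "A \<in> {A. range A \<subseteq> sets borel \<and> disjoint_family A \<and> (\<Union>i. A i) = B}"
  then have A: "range A \<subseteq> sets borel" "disjoint_family A" "(\<Union>i. A i) = B" by auto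
  have "(\<lambda>i. \<mu> (A i)) sums \<mu> B"
    using \<mu> A unfolding vector_measure_def by metis
  from bounded_linear.sums[OF bounded_linear_inner_left this]
  have "(\<lambda>i. \<mu> (A i) \<bullet> u) sums (\<mu> B \<bullet> u)" .
  from sums_divide[OF sums_minus[OF this]]
  have s: "(\<lambda>i. - (\<mu> (A i) \<bullet> u) / c) sums (- (\<mu> B \<bullet> u) / c)" .
  have le': "norm (\<mu> (A i)) \<le> - (\<mu> (A i) \<bullet> u) / c" for i
    using le[of "A i"] A c by (auto simp: field_simps)
  have nn: "0 \<le> - (\<mu> (A i) \<bullet> u) / c" for i
    using le'[of i] norm_ge_zero order_trans by blast
  have "(\<Sum>i. ennreal (norm (\<mu> (A i)))) \<le> (\<Sum>i. ennreal (- (\<mu> (A i) \<bullet> u) / c))"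
    using le' by (intro suminf_le ennreal_leI) auto
  also have "\<dots> = ennreal (- (\<mu> B \<bullet> u) / c)"
    using suminf_ennreal2[OF nn sums_summable[OF s]] sums_unique[OF s] by simp
  finally show "(\<Sum>i. ennreal (norm (\<mu> (A i)))) \<le> ennreal (- (\<mu> B \<bullet> u) / c)" .
qed

lemma distributional_gradient_gradient_of_indicator:
  "finite_perimeter E \<Longrightarrow> distributional_gradient_of_indicator E (gradient_of_indicator E)"
  using someI_ex[of "distributional_gradient_of_indicator E"]
  by (auto simp: finite_perimeter_def gradient_of_indicator_def)

text \<open>In a small ball inside \<open>E\<close>, or disjoint from its closure, \<open>E\<close>
  is stable under shifts in every direction. The gradient therefore vanishes there, against the
  positivity of its total variation.\<close>

lemma reduced_boundary_subset_frontier: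
  fixes E :: "'a::euclidean_space set"
  assumes "open E" "bounded E"
  shows "reduced_boundary E \<subseteq> frontier E"
proof
  fix x assume x: "x \<in> reduced_boundary E"
  let ?\<mu> = "gradient_of_indicator E"
  have \<mu>: "distributional_gradient_of_indicator E ?\<mu>" and
    tv: "\<And>r. r > 0 \<Longrightarrow> total_variation ?\<mu> (ball x r) > 0"
    using x distributional_gradient_gradient_of_indicator by (auto simp: reduced_boundary_def)
  show "x \<in> frontier E"
  proof (rule ccontr)
    assume "x \<notin> frontier E"
    then have "x \<in> E \<or> x \<in> - closure E"
      using assms by (auto simp: frontier_def interior_open)
    then obtain r where r: "r > 0" "ball x r \<subseteq> E \<or> ball x r \<subseteq> - closure E"
      using assms(1) open_contains_ball[of E] open_contains_ball[of "- closure E"]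
      by (metis closed_closure open_Compl)
    have "?\<mu> A \<bullet> v \<le> 0" if "A \<in> sets borel" "A \<subseteq> ball x r" for A v
      by (rule gradient_inner_nonpos[OF assms \<mu> open_ball that])
         (use r closure_subset in blast)
    \<comment> \<open>The cone bound with centre 0 and radius 1 forces
      \<open>\<mu> A = 0\<close>.\<close>
    then have "1 * norm (?\<mu> A) \<le> - (?\<mu> A \<bullet> 0)" if "A \<in> sets borel" "A \<subseteq> ball x r" for A
      using that by (intro norm_le_of_cone_nonpos) auto
    then have "total_variation ?\<mu> (ball x r) \<le> ennreal (- (?\<mu> (ball x r) \<bullet> 0) / 1)"
      using \<mu> by (intro total_variation_le) (auto simp: distributional_gradient_of_indicator_def)
    then show False using tv[OF r(1)] by simp
  qed
qed

text \<open>On small balls the total variation is at most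
  \<open>- (\<mu> (ball x r) \<bullet> u) / c\<close>. Dividing by the total variation bounds the
  density quotient, and the bound survives the limit; the sign in \<open>outer_normal\<close> turns
  it into a lower bound.\<close>

lemma outer_normal_inner_ge:
  fixes E :: "'a::euclidean_space set"
  assumes E: "open E" "bounded E" and "c > 0" and x: "x \<in> reduced_boundary E" "x \<in> B" "open B"
    and down: "\<And>v y t. \<lbrakk>norm (v - u) \<le> c; y \<in> B; y \<in> E; t > 0; y - t *\<^sub>R v \<in> B\<rbrakk> \<Longrightarrow> y - t *\<^sub>R v \<in> E"
  shows "outer_normal E x \<bullet> u \<ge> c"
proof -
  let ?\<mu> = "gradient_of_indicator E"
  obtain l where l: "(density_quotient E x \<longlongrightarrow> l) (at_right 0)" and
    \<mu>: "distributional_gradient_of_indicator E ?\<mu>" and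
    tv: "\<And>r. r > 0 \<Longrightarrow> total_variation ?\<mu> (ball x r) > 0"
    using x distributional_gradient_gradient_of_indicator by (auto simp: reduced_boundary_def)
  have ev: "\<forall>\<^sub>F r in at_right 0. c \<le> - (density_quotient E x r \<bullet> u)"
  proof -
    obtain r0 where r0: "r0 > 0" "ball x r0 \<subseteq> B"
      using x open_contains_ball by blast
    have "c \<le> - (density_quotient E x r \<bullet> u)" if r: "0 < r" "r < r0" for r
    proof -
      have sub: "ball x r \<subseteq> B" using r r0 by fastforce
      have le: "c * norm (?\<mu> A) \<le> - (?\<mu> A \<bullet> u)" if A: "A \<in> sets borel" "A \<subseteq> ball x r" for A
      proof (rule norm_le_of_cone_nonpos[OF \<open>c > 0\<close>])
        fix v assume v: "norm (v - u) \<le> c"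
        show "?\<mu> A \<bullet> v \<le> 0"
          by (rule gradient_inner_nonpos[OF E \<mu> x(3) A(1)]) (use A(2) sub down[OF v] in auto)
      qed
      have tv_le: "total_variation ?\<mu> (ball x r) \<le> ennreal (- (?\<mu> (ball x r) \<bullet> u) / c)"
        using \<mu> by (intro total_variation_le le \<open>c > 0\<close>) (auto simp: distributional_gradient_of_indicator_def)
      define T where "T = enn2real (total_variation ?\<mu> (ball x r))"
      \<comment> \<open>The bound \<open>tv_le\<close> makes the total variation finite, so
        \<open>enn2real\<close> does not send it to 0.\<close>
      have T: "T > 0" unfolding T_def
        using tv[OF r(1)] tv_le by (simp add: enn2real_positive_iff le_less_trans)
      \<comment> \<open>Positivity shows that \<open>ennreal\<close> has not truncated a negative
        real, so the bound can be read in the reals.\<close>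
      have "0 < ennreal (- (?\<mu> (ball x r) \<bullet> u) / c)" using tv[OF r(1)] tv_le by (rule less_le_trans)
      then have "T \<le> - (?\<mu> (ball x r) \<bullet> u) / c"
        unfolding T_def using enn2real_mono[OF tv_le] by (simp add: enn2real_ennreal less_imp_le)
      then have "c \<le> - (?\<mu> (ball x r) \<bullet> u) / T" using T \<open>c > 0\<close> by (simp add: field_simps)
      also have "\<dots> = - (density_quotient E x r \<bullet> u)"
        by (simp add: density_quotient_def T_def divide_inverse mult.commute)
      finally show ?thesis .
    qed
    then show ?thesis
      unfolding eventually_at_right_field using r0(1) by blast
  qed
  have "((\<lambda>r. - (density_quotient E x r \<bullet> u)) \<longlongrightarrow> - (l \<bullet> u)) (at_right 0)"
    by (intro tendsto_intros l)
  from tendsto_lowerbound[OF this ev] have "c \<le> - (l \<bullet> u)" by simp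
  moreover have "outer_normal E x = - l"
    unfolding outer_normal_def using tendsto_Lim[OF _ l] by simp
  ultimately show ?thesis by simp
qed

section \<open>The cone property of Lipschitz sets\<close>

text \<open>Moving by \<open>- t v\<close> lowers the point by at least \<open>t * (1 - c)\<close>
  and shifts it sideways by at most \<open>t * c\<close>, so the graph drops by at most
  \<open>L * t * c\<close>. A small enough \<open>c\<close> keeps the point strictly below the
  graph.\<close>

lemma Lipschitz_open_set_cone:
  fixes E :: "'a::euclidean_space set"
  assumes "Lipschitz_open_set E" "x \<in> frontier E"
  obtains B u c where "open B" "x \<in> B" "c > 0"
    "\<And>v y t. \<lbrakk>norm (v - u) \<le> c; y \<in> B; y \<in> E; t > 0; y - t *\<^sub>R v \<in> B\<rbrakk> \<Longrightarrow> y - t *\<^sub>R v \<in> E"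
proof -
  obtain U Q a e g L where U: "open U" "x \<in> U" and Q: "orthogonal_transformation Q" and e: "e \<in> Basis"
    and g: "L-lipschitz_on {z. z \<bullet> e = 0} (g :: 'a \<Rightarrow> real)"
    and EU: "U \<inter> E = {y \<in> U. (a + Q y) \<bullet> e < g ((a + Q y) - ((a + Q y) \<bullet> e) *\<^sub>R e)}"
    using assms unfolding Lipschitz_open_set_def Let_def by blast
  have lin: "linear Q" using Q by (rule orthogonal_transformation_linear)
  have ee: "e \<bullet> e = 1" using e by (simp add: inner_Basis)
  have L: "L \<ge> 0" using g by (rule lipschitz_on_nonneg)
  obtain u where u: "Q u = e"
    using orthogonal_transformation_surj[OF Q] by (metis surjD)
  \<comment> \<open>This value solves \<open>L * c = 1 - c\<close>, balancing the drop of the graph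
    against that of the point.\<close>
  define c where "c = 1 / (1 + L)"
  have c: "c > 0" "L * c \<le> 1 - c" using L by (auto simp: c_def field_simps)
  define rest where "rest z = z - (z \<bullet> e) *\<^sub>R e" for z
  have rest0: "rest z \<bullet> e = 0" for z by (simp add: rest_def inner_diff_left ee)
  have norm_rest: "norm (rest z) \<le> norm z" for z
  proof -
    have "rest z \<bullet> rest z = z \<bullet> z - (z \<bullet> e)\<^sup>2"
      by (simp add: rest_def inner_diff_left inner_diff_right ee inner_commute power2_eq_square)
    then show ?thesis by (simp add: norm_le)
  qed
  show ?thesis
  proof (rule that[OF U c(1)])
    fix v y t
    assume v: "norm (v - u) \<le> c" and y: "y \<in> U" "y \<in> E" and t: "t > 0" and yt: "y - t *\<^sub>R v \<in> U"
    define w where "w = Q (v - u)"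
    have w: "norm w \<le> c" using v Q by (simp add: w_def orthogonal_transformation_norm)
    have Qv: "Q v = e + w" using u by (simp add: w_def linear_diff[OF lin])
    have "rest e = 0" by (simp add: rest_def ee)
    then have rest_v: "rest (Q v) = rest w"
      by (simp add: Qv rest_def inner_add_left algebra_simps)
    have "\<bar>w \<bullet> e\<bar> \<le> norm w * norm e" by (rule Cauchy_Schwarz_ineq2)
    then have "\<bar>w \<bullet> e\<bar> \<le> c" using w e by simp
    then have vert: "Q v \<bullet> e \<ge> 1 - c" by (simp add: Qv inner_add_left ee)
    define T where "T = a + Q y"
    have T': "a + Q (y - t *\<^sub>R v) = T - t *\<^sub>R Q v"
      by (simp add: T_def linear_diff[OF lin] linear_cmul[OF lin])
    have below: "T \<bullet> e < g (rest T)" using EU y unfolding T_def rest_def by blast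
    have "rest (T - t *\<^sub>R Q v) - rest T = - t *\<^sub>R rest (Q v)"
      by (simp add: rest_def inner_diff_left algebra_simps)
    then have "dist (rest (T - t *\<^sub>R Q v)) (rest T) = t * norm (rest w)"
      using t by (simp add: dist_norm rest_v)
    moreover have "dist (g (rest (T - t *\<^sub>R Q v))) (g (rest T)) \<le> L * dist (rest (T - t *\<^sub>R Q v)) (rest T)"
      by (rule lipschitz_onD[OF g]) (simp_all add: rest0)
    ultimately have "g (rest T) - g (rest (T - t *\<^sub>R Q v)) \<le> L * (t * norm (rest w))"
      by (simp add: dist_real_def)
    also have "\<dots> \<le> L * (t * c)"
      using L t w norm_rest[of w] by (intro mult_left_mono) auto
    also have "\<dots> = t * (L * c)" by simp
    also have "\<dots> \<le> t * (Q v \<bullet> e)" using t c(2) vert by (intro mult_left_mono) auto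
    finally have "(T - t *\<^sub>R Q v) \<bullet> e < g (rest (T - t *\<^sub>R Q v))"
      using below by (simp add: inner_diff_left)
    then show "y - t *\<^sub>R v \<in> E"
      using EU yt unfolding T'[symmetric] rest_def by blast
  qed
qed

section \<open>Gluing the local directions\<close>

lemma hausdorff_measure_empty: "hausdorff_measure k ({} :: 'a::euclidean_space set) = 0"
proof -
  have "hausdorff_premeasure k \<delta> ({} :: 'a set) \<le> (\<Sum>i::nat. hausdorff_weight k ({} :: 'a set))"
    if "\<delta> > 0" for \<delta>
    unfolding hausdorff_premeasure_def using that by (intro INF_lower) auto
  then have "hausdorff_premeasure k \<delta> ({} :: 'a set) = 0" if "\<delta> > 0" for \<delta>
    using that by (simp add: hausdorff_weight_def)
  then show ?thesis
    unfolding hausdorff_measure_def by (intro antisym SUP_least) auto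
qed

theorem proposition3p4:
  fixes E :: "(real ^ 'n) set"
  assumes "Lipschitz_open_set E" and "bounded E"
  shows "\<exists>\<xi>\<^sub>0 \<in> Theta_space. \<exists>\<eta>>0.
           hausdorff_measure (CARD('n) - 1)
             {x \<in> reduced_boundary E. \<not> \<xi>\<^sub>0 x \<bullet> outer_normal E x \<ge> \<eta>} = 0"
proof -
  have E: "open E" using assms by (simp add: Lipschitz_open_set_def)
  have "\<exists>r u c. r > 0 \<and> c > 0 \<and> (\<forall>z \<in> reduced_boundary E \<inter> ball x r. outer_normal E z \<bullet> u \<ge> c)"
    if "x \<in> frontier E" for x
  proof -
    obtain B u c where B: "open B" "x \<in> B" "c > 0"
      "\<And>v y t. \<lbrakk>norm (v - u) \<le> c; y \<in> B; y \<in> E; t > 0; y - t *\<^sub>R v \<in> B\<rbrakk> \<Longrightarrow> y - t *\<^sub>R v \<in> E"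
      by (rule Lipschitz_open_set_cone[OF assms(1) \<open>x \<in> frontier E\<close>]) (rule that; assumption)
    obtain r where r: "r > 0" "ball x r \<subseteq> B"
      using B(1,2) open_contains_ball by blast
    have "outer_normal E z \<bullet> u \<ge> c" if "z \<in> reduced_boundary E \<inter> ball x r" for z
      using that r(2) by (intro outer_normal_inner_ge[OF E assms(2) B(3) _ _ B(1) B(4)]) auto
    then show ?thesis using r(1) B(3) by blast
  qed
  then obtain r u c where r: "\<And>x. x \<in> frontier E \<Longrightarrow> r x > 0" and c: "\<And>x. x \<in> frontier E \<Longrightarrow> c x > 0"
    and normal: "\<And>x z. \<lbrakk>x \<in> frontier E; z \<in> reduced_boundary E; z \<in> ball x (r x)\<rbrakk> \<Longrightarrow> outer_normal E z \<bullet> u x \<ge> c x"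
    by (metis IntI)
  have "compact (frontier E)" using assms(2) by (rule compact_frontier_bounded)
  then obtain C where C: "C \<subseteq> frontier E" "finite C" "frontier E \<subseteq> (\<Union>x\<in>C. ball x (r x))"
    by (rule compactE_image[of "frontier E" "frontier E" "\<lambda>x. ball x (r x)"]) (use r in force)+
  \<comment> \<open>The bumps are not normalised to a partition of unity: \<open>s\<close> bounds
    the normal component of \<open>\<xi>\<close> from below, and compactness of the frontier gives
    \<open>s\<close> a positive minimum.\<close>
  define \<xi> where "\<xi> y = (\<Sum>x\<in>C. bump x (r x) y *\<^sub>R u x)" for y
  define s where "s y = (\<Sum>x\<in>C. bump x (r x) y * c x)" for y
  have s_pos: "s y > 0" if y: "y \<in> frontier E" for y
  proof -
    obtain x where x: "x \<in> C" "y \<in> ball x (r x)" using C(3) y by blast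
    then have "bump x (r x) y * c x > 0"
      using C(1) r c bump_pos_iff by (metis mult_pos_pos subsetD)
    then show ?thesis
      unfolding s_def using C x(1) c
      by (intro sum_pos2[of _ x] mult_nonneg_nonneg bump_nonneg) (auto simp: less_imp_le subsetD)
  qed
  have "continuous_on (frontier E) s"
    unfolding s_def
    by (intro continuous_intros continuous_on_subset[OF C1_on_space_imp_continuous_on[OF C1_on_space_bump]]) auto
  then have "\<exists>\<eta>>0. \<forall>y\<in>frontier E. \<eta> \<le> s y"
    using continuous_attains_inf[OF \<open>compact (frontier E)\<close>, of s] s_pos
    \<comment> \<open>With an empty frontier there is no minimum to take, and
      \<open>\<eta> = 1\<close> serves.\<close>
    by (cases "frontier E = {}") (auto intro: exI[of _ 1])
  then obtain \<eta> where \<eta>: "\<eta> > 0" "\<And>y. y \<in> frontier E \<Longrightarrow> \<eta> \<le> s y" by blast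
  have "\<xi> \<in> Theta_space"
    unfolding \<xi>_def[abs_def]
    by (intro Theta_space_sum Theta_space_scaleR C1_on_space_bump compact_closure_support_bump r)
       (use C in auto)
  have "\<xi> y \<bullet> outer_normal E y \<ge> \<eta>" if y: "y \<in> reduced_boundary E" for y
  proof -
    have "\<eta> \<le> s y"
      using \<eta>(2) reduced_boundary_subset_frontier[OF E assms(2)] y by blast
    also have "s y \<le> (\<Sum>x\<in>C. bump x (r x) y * (u x \<bullet> outer_normal E y))"
      unfolding s_def
    proof (rule sum_mono)
      fix x assume "x \<in> C"
      then have x: "x \<in> frontier E" using C by blast
      show "bump x (r x) y * c x \<le> bump x (r x) y * (u x \<bullet> outer_normal E y)"
      \<comment> \<open>The bound on the normal is known only inside the ball; outside, the bump
        vanishes and both sides are 0.\<close>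
      proof (cases "y \<in> ball x (r x)")
        case True
        then show ?thesis
          using normal[OF x y] by (intro mult_left_mono bump_nonneg) (simp add: inner_commute)
      next
        case False
        then show ?thesis using bump_eq_0[OF r[OF x] False] by simp
      qed
    qed
    also have "\<dots> = \<xi> y \<bullet> outer_normal E y" by (simp add: \<xi>_def inner_sum_left)
    finally show ?thesis .
  qed
  then have empty: "{x \<in> reduced_boundary E. \<not> \<xi> x \<bullet> outer_normal E x \<ge> \<eta>} = {}" by blast
  show ?thesis
  proof (intro bexI exI conjI)
    show "hausdorff_measure (CARD('n) - 1) {x \<in> reduced_boundary E. \<not> \<xi> x \<bullet> outer_normal E x \<ge> \<eta>} = 0"
      unfolding empty by (rule hausdorff_measure_empty)
  qed fact+
qed

end
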